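(* Let $c$ be a random vector with nonatomic distribution over $\mathbb S_{n_y}$, and let $\{\hat c_1,\dots,\hat c_{N_0}\}$ be an independent sample of $c$. For $x\in X$ and $i\in\{1,\dots,N_0\}$ let $y_i(x)$ denote the unique element (when it is unique) of $\operatorname{argmin}_y\{\langle\hat c_i,y\rangle: A_fx+B_fy\le b_f\}$. Then, with probability 1, the function $\theta:X\to\mathbb R$ given by $$\theta(x):=\langle d_1,x\rangle+\frac1{N_0}\sum_{i=1}^{N_0}\langle d_2,y_i(x)\rangle$$ is well-defined and it is piecewise linear over the chamber complex $\mathscr C(D)$.
   Context: Data: $A_l\in\mathbb R^{m_l\times n_x}$, $A_f\in\mathbb R^{m_f\times n_x}$, $B_f\in\mathbb R^{m_f\times n_y}$, $b_l\in\mathbb R^{m_l}$, $b_f\in\mathbb R^{m_f}$, $d_1\in\mathbb R^{n_x}$, $d_2\in\mathbb R^{n_y}$. Put $D=\{(x,y)\in\mathbb R^{n_x}\times\mathbb R^{n_y}: A_lx\le b_l,\ A_fx+B_fy\le b_f\}$, assumed compact and full-dimensional, $\pi(x,y)=x$, and $X=\pi(D)$. $\mathbb S_{n_y}$ is the unit sphere of $\mathbb R^{n_y}$. A random vector $c:\Omega\to\mathbb S_{n_y}$ on a probability space $(\Omega,\Sigma,\mathbb P)$ has nonatomic distribution if for every Borel $O\subseteq\mathbb S_{n_y}$, $\mathcal H^{n_y-1}(O)=0$ implies $\mathbb P[c(\omega)\in O]=0$, where $\mathcal H^{n_y-1}$ is the $(n_y-1)$-dimensional Hausdorff measure. A face of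 a polytope $P$ is the set of maximizers over $P$ of a linear function ($P$ itself is a face); $\mathscr F(D)$ is the set of all faces of $D$. For $x\in X$ the chamber of $x$ is $\sigma(x)=\bigcap\{\pi(F):F\in\mathscr F(D),\ x\in\pi(F)\}$ and the chamber complex is $\mathscr C(D)=\{\sigma(x):x\in X\}$. A function $f:X\to\mathbb R$ is piecewise linear over $\mathscr C(D)$ if there are pairs $(d_C,a_C)\in\mathbb R^{n_x}\times\mathbb R$, $C\in\mathscr C(D)$, such that $f(x)=\sum_{C\in\mathscr C(D)}(\langle d_C,x\rangle+a_C)\mathbf 1_{\mathrm{ri}(C)}(x)$ for all $x\in X$ (ri = relative interior). *)

theory Defs
  imports "HOL-Probability.Probability"
begin

text \<open>
  The order on vectors is the componentwise one. A system without rows is not a separate case: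
  it has the same solutions as the single row \<open>0 * x \<le> 0\<close>.
\<close>

definition feasible_set ::
  "real^'nx^'ml \<Rightarrow> real^'ml \<Rightarrow> real^'nx^'mf \<Rightarrow> real^'ny^'mf \<Rightarrow> real^'mf \<Rightarrow> ((real^'nx) \<times> (real^'ny)) set"
  where "feasible_set A\<^sub>l b\<^sub>l A\<^sub>f B\<^sub>f b\<^sub>f = {(x, y). A\<^sub>l *v x \<le> b\<^sub>l \<and> A\<^sub>f *v x + B\<^sub>f *v y \<le> b\<^sub>f}"

definition full_dimensional :: "'a::euclidean_space set \<Rightarrow> bool"
  where "full_dimensional P \<longleftrightarrow> aff_dim P = int DIM('a)"


text \<open>
  Hausdorff measure of integer dimension \<open>k\<close>, as a set function, normalised so that for
  \<open>k = DIM('a)\<close> it is Lebesgue outer measure. The empty set gets gauge 0 and a singleton gets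
  \<open>0 ^ k\<close>, so that \<open>k = 0\<close> gives the counting measure (needed for the sphere in dimension one).
  Covering sets must be bounded because \<open>diameter\<close> has no meaningful value on unbounded sets.
\<close>

definition hausdorff_gauge :: "nat \<Rightarrow> 'a::metric_space set \<Rightarrow> ennreal"
  where "hausdorff_gauge k U =
    (if U = {} then 0 else ennreal (unit_ball_vol (real k) * (diameter U / 2) ^ k))"

definition hausdorff_premeasure :: "nat \<Rightarrow> real \<Rightarrow> 'a::metric_space set \<Rightarrow> ennreal"
  where "hausdorff_premeasure k \<delta> A =
    (INF U \<in> {U :: nat \<Rightarrow> 'a set. A \<subseteq> (\<Union>i. U i) \<and> (\<forall>i. bounded (U i) \<and> diameter (U i) \<le> \<delta>)}.
       \<Sum>i. hausdorff_gauge k (U i))"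

definition hausdorff_measure :: "nat \<Rightarrow> 'a::metric_space set \<Rightarrow> ennreal"
  where "hausdorff_measure k A = (SUP \<delta> \<in> {0<..}. hausdorff_premeasure k \<delta> A)"


abbreviation sphere_borel :: "'a::euclidean_space measure"
  where "sphere_borel \<equiv> restrict_space borel (sphere 0 1)"

definition nonatomic_distribution :: "'w measure \<Rightarrow> ('w \<Rightarrow> 'a::euclidean_space) \<Rightarrow> bool"
  where "nonatomic_distribution M c \<longleftrightarrow>
    (\<forall>O' \<in> sets borel. O' \<subseteq> sphere 0 1 \<longrightarrow> hausdorff_measure (DIM('a) - 1) O' = 0 \<longrightarrow>
       measure M {\<omega> \<in> space M. c \<omega> \<in> O'} = 0)"

text \<open>The sample may live on a probability space \<open>M'\<close> other than the space \<open>M\<close> of \<open>c\<close>.\<close>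

definition independent_sample ::
  "'v measure \<Rightarrow> (nat \<Rightarrow> 'v \<Rightarrow> 'a::euclidean_space) \<Rightarrow> nat set \<Rightarrow> 'w measure \<Rightarrow> ('w \<Rightarrow> 'a) \<Rightarrow> bool"
  where "independent_sample M' c' I M c \<longleftrightarrow>
    prob_space.indep_vars M' (\<lambda>_. sphere_borel) c' I \<and>
    (\<forall>i \<in> I. distr M' sphere_borel (c' i) = distr M sphere_borel c)"


text \<open>
  Faces in the sense of sets of maximizers of linear functions; unlike for \<open>face_of\<close>, the empty
  set is not a face of a nonempty polytope.
\<close>

definition faces :: "'a::euclidean_space set \<Rightarrow> 'a set set"
  where "faces P = {F. \<exists>f :: 'a \<Rightarrow> real. linear f \<and> F = {z. is_arg_max f (\<lambda>z. z \<in> P) z}}"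

definition chamber :: "('a::euclidean_space \<times> 'b::euclidean_space) set \<Rightarrow> 'a \<Rightarrow> 'a set"
  where "chamber D x = \<Inter> {fst ` F |F. F \<in> faces D \<and> x \<in> fst ` F}"

definition chamber_complex :: "('a::euclidean_space \<times> 'b::euclidean_space) set \<Rightarrow> 'a set set"
  where "chamber_complex D = chamber D ` (fst ` D)"

text \<open>Finiteness of the complex makes the sum meaningful (\<open>sum\<close> is 0 on infinite sets).\<close>

definition piecewise_linear_over ::
  "('a::euclidean_space \<Rightarrow> real) \<Rightarrow> 'a set \<Rightarrow> 'a set set \<Rightarrow> bool"
  where "piecewise_linear_over f X \<C> \<longleftrightarrow> finite \<C> \<and>
    (\<exists>(d :: 'a set \<Rightarrow> 'a) (a :: 'a set \<Rightarrow> real). \<forall>x \<in> X.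
       f x = (\<Sum>C\<in>\<C>. (d C \<bullet> x + a C) * indicator (rel_interior C) x))"


definition lower_argmin ::
  "real^'nx^'mf \<Rightarrow> real^'ny^'mf \<Rightarrow> real^'mf \<Rightarrow> real^'ny \<Rightarrow> real^'nx \<Rightarrow> (real^'ny) set"
  where "lower_argmin A\<^sub>f B\<^sub>f b\<^sub>f c x =
    {y. is_arg_min (\<lambda>y. c \<bullet> y) (\<lambda>y. A\<^sub>f *v x + B\<^sub>f *v y \<le> b\<^sub>f) y}"

definition lower_solution ::
  "real^'nx^'mf \<Rightarrow> real^'ny^'mf \<Rightarrow> real^'mf \<Rightarrow> real^'ny \<Rightarrow> real^'nx \<Rightarrow> real^'ny"
  where "lower_solution A\<^sub>f B\<^sub>f b\<^sub>f c x = (THE y. y \<in> lower_argmin A\<^sub>f B\<^sub>f b\<^sub>f c x)"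

definition sample_average ::
  "real^'nx^'mf \<Rightarrow> real^'ny^'mf \<Rightarrow> real^'mf \<Rightarrow> real^'nx \<Rightarrow> real^'ny \<Rightarrow> nat \<Rightarrow> (nat \<Rightarrow> real^'ny)
    \<Rightarrow> real^'nx \<Rightarrow> real"
  where "sample_average A\<^sub>f B\<^sub>f b\<^sub>f d\<^sub>1 d\<^sub>2 N c x =
    d\<^sub>1 \<bullet> x + 1 / real N * (\<Sum>i = 1..N. d\<^sub>2 \<bullet> lower_solution A\<^sub>f B\<^sub>f b\<^sub>f (c i) x)"

end

theory Submission
  imports Defs
begin

text \<open>
  Write the polytope as \<open>D = {z. \<forall>i. a i \<bullet> z \<le> \<beta> i}\<close>, and for \<open>x \<in> X\<close> let \<open>{y. (x, y) \<in> D}\<close> be its fibre.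
  For \<open>x \<in> X\<close> the lower-level feasible set is exactly this fibre, which is compact, so minimizers exist.

  \<^bold>\<open>Uniqueness.\<close> If \<open>y \<noteq> y'\<close> both minimize \<open>e \<bullet> y\<close> over a fibre, let \<open>J\<close> be the rows active at their midpoint.
  The minimizers satisfy the rows in \<open>J\<close> with equality, so the \<open>y\<close>-parts of these rows have a
  nonzero common kernel. Along each kernel direction one can move both ways from the midpoint, hence
  \<open>e\<close> is orthogonal to the whole kernel, in particular to a nonzero vector \<open>v J\<close> chosen in advance.
  There are finitely many sets \<open>J\<close>, so it suffices that the sample avoids finitely many great
  subspheres \<open>{z. norm z = 1 \<and> v J \<bullet> z = 0}\<close>. These are null sets for the Hausdorff measure of
  dimension \<open>n - 1\<close> by a packing argument
  (\<open>hausdorff_measure_great_subsphere\<close>), so nonatomicity makes this happen almost surely.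

  \<^bold>\<open>Chambers.\<close> A direction that does not increase the active rows is feasible for a short time
  (\<open>feasible_direction\<close>); this replaces linear programming duality throughout. It shows that the
  face of points at which all rows active at \<open>z\<close> are active lies in every face containing \<open>z\<close>,
  so the chamber of \<open>x\<close> is the intersection of the projections of the faces cut out by the active
  sets over \<open>x\<close>. Hence there are finitely many chambers and \<open>x\<close> lies in the relative interior of
  its own. Moreover, if \<open>y'\<close> is optimal for a linear function over the fibre of \<open>x'\<close>, then every
  point of the face cut out by the rows active at \<open>(x', y')\<close> is optimal in its own fibre
  (\<open>fibre_optimality_transfer\<close>), and this face projects onto a set containing the chamber of \<open>x'\<close>.
  Two consequences follow: the relative interiors of distinct chambers are disjoint
  (\<open>chamber_eqI\<close>), and over a chamber the unique minimizers all lie in one affine subspace on which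
  the projection is injective, so they depend affinely on \<open>x\<close> (\<open>fibre_minimizer_affine\<close>).
\<close>

section \<open>Polyhedra given by linear inequalities, and their chambers\<close>

text \<open>
  A finite system of inequalities \<open>a i \<bullet> z \<le> \<beta> i\<close> in a product space; \<open>fst\<close> is the projection whose
  chambers are studied. A row may be zero.
\<close>

locale linear_system =
  fixes I :: "'i set" and a :: "'i \<Rightarrow> 'a::euclidean_space \<times> 'b::euclidean_space" and \<beta> :: "'i \<Rightarrow> real"
  assumes finite_rows: "finite I"
begin

definition solutions :: "('a \<times> 'b) set"
  where "solutions = {z. \<forall>i\<in>I. a i \<bullet> z \<le> \<beta> i}"

text \<open>The rows that hold with equality at a point.\<close>

definition active :: "'a \<times> 'b \<Rightarrow> 'i set"
  where "active z = {i\<in>I. a i \<bullet> z = \<beta> i}"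

text \<open>
  The solutions at which all rows in \<open>J\<close> hold with equality. For \<open>J = active z\<close> this is the smallest
  face containing \<open>z\<close>.
\<close>

definition tight_face :: "'i set \<Rightarrow> ('a \<times> 'b) set"
  where "tight_face J = {w \<in> solutions. \<forall>i\<in>J. a i \<bullet> w = \<beta> i}"

lemma active_subset: "active z \<subseteq> I"
  by (auto simp: active_def)

lemma tight_activeI: "z \<in> solutions \<Longrightarrow> z \<in> tight_face (active z)"
  by (auto simp: tight_face_def active_def)

lemma convex_tight: "convex (tight_face J)"
proof -
  have "tight_face J = (\<Inter>i\<in>I. {w. a i \<bullet> w \<le> \<beta> i}) \<inter> (\<Inter>i\<in>J. {w. a i \<bullet> w = \<beta> i})"
    by (auto simp: tight_face_def solutions_def)
  then show ?thesis
    by (simp add: convex_Int convex_INT convex_halfspace_le convex_hyperplane)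
qed

lemma feasible_direction:
  assumes z: "z \<in> solutions" and v: "\<And>i. i \<in> active z \<Longrightarrow> a i \<bullet> v \<le> 0"
  shows "\<exists>\<epsilon>>0. \<forall>t. 0 \<le> t \<and> t \<le> \<epsilon> \<longrightarrow> z + t *\<^sub>R v \<in> solutions"
proof -
  have row: "\<forall>\<^sub>F t in at_right 0. a i \<bullet> (z + t *\<^sub>R v) \<le> \<beta> i" if i: "i \<in> I" for i
  proof (cases "i \<in> active z")
    case True
    then have "a i \<bullet> z = \<beta> i" "a i \<bullet> v \<le> 0" using v by (auto simp: active_def)
    then show ?thesis
      by (intro eventually_at_rightI[of 0 1]) (auto simp: inner_add_right mult_nonneg_nonpos)
  next
    case False
    then have "a i \<bullet> z < \<beta> i" using z i by (force simp: active_def solutions_def)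
    moreover have "((\<lambda>t. a i \<bullet> (z + t *\<^sub>R v)) \<longlongrightarrow> a i \<bullet> (z + 0 *\<^sub>R v)) (at_right 0)"
      by (intro tendsto_intros)
    ultimately have "\<forall>\<^sub>F t in at_right 0. a i \<bullet> (z + t *\<^sub>R v) < \<beta> i"
      by (intro order_tendstoD(2)) auto
    then show ?thesis by eventually_elim simp
  qed
  then have "\<forall>\<^sub>F t in at_right 0. \<forall>i\<in>I. a i \<bullet> (z + t *\<^sub>R v) \<le> \<beta> i"
    using finite_rows by (simp add: eventually_ball_finite)
  then obtain b where b: "0 < b" "\<And>t. 0 < t \<Longrightarrow> t < b \<Longrightarrow> z + t *\<^sub>R v \<in> solutions"
    unfolding eventually_at_right[OF zero_less_one] solutions_def by auto
  show ?thesis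
  proof (intro exI[of _ "b / 2"] conjI allI impI)
    fix t assume "0 \<le> t \<and> t \<le> b / 2"
    then show "z + t *\<^sub>R v \<in> solutions"
      using b z by (cases "t = 0") auto
  qed (use b in simp)
qed

text \<open>The face exposed by the sum of the active rows.\<close>

lemma tight_in_faces:
  assumes "z \<in> solutions"
  shows "tight_face (active z) \<in> faces solutions"
proof -
  define f where "f w = (\<Sum>i\<in>active z. a i \<bullet> w)" for w
  have fin: "finite (active z)"
    using active_subset finite_rows finite_subset by blast
  have "linear f"
    unfolding f_def by (intro linear_compose_sum ballI bounded_linear.linear bounded_linear_inner_right)
  moreover have "tight_face (active z) = {w. is_arg_max f (\<lambda>w. w \<in> solutions) w}"
  proof -
    have bd: "a i \<bullet> w \<le> \<beta> i" if "i \<in> active z" "w \<in> solutions" for i w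
      using that by (auto simp: solutions_def active_def)
    have le: "f w \<le> (\<Sum>i\<in>active z. \<beta> i)" if "w \<in> solutions" for w
      unfolding f_def by (intro sum_mono bd that)
    have fz: "f z = (\<Sum>i\<in>active z. \<beta> i)"
      unfolding f_def by (intro sum.cong) (auto simp: active_def)
    have "is_arg_max f (\<lambda>w. w \<in> solutions) w \<longleftrightarrow> w \<in> solutions \<and> f w = (\<Sum>i\<in>active z. \<beta> i)" for w
      unfolding is_arg_max_linorder using le assms fz by (metis order_antisym)
    moreover have "f w = (\<Sum>i\<in>active z. \<beta> i) \<longleftrightarrow> (\<forall>i\<in>active z. a i \<bullet> w = \<beta> i)" if "w \<in> solutions" for w
    proof
      assume "f w = (\<Sum>i\<in>active z. \<beta> i)"
      then have "(\<Sum>i\<in>active z. \<beta> i - a i \<bullet> w) = 0"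
        by (simp add: f_def sum_subtractf)
      then show "\<forall>i\<in>active z. a i \<bullet> w = \<beta> i"
        using bd that fin by (subst (asm) sum_nonneg_eq_0_iff) auto
    qed (simp add: f_def)
    ultimately show ?thesis by (auto simp: tight_face_def)
  qed
  ultimately show ?thesis by (auto simp: faces_def)
qed

text \<open>\<open>z\<close> is a relative interior point of the face that its active rows cut out.\<close>

lemma extend_beyond:
  assumes z: "z \<in> solutions" and w: "w \<in> tight_face (active z)"
  shows "\<exists>\<epsilon>>0. \<forall>t. 0 \<le> t \<and> t \<le> \<epsilon> \<longrightarrow> z + t *\<^sub>R (z - w) \<in> tight_face (active z)"
proof -
  have eq: "a i \<bullet> z = \<beta> i" "a i \<bullet> w = \<beta> i" if "i \<in> active z" for i
    using w that by (auto simp: tight_face_def active_def)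
  obtain \<epsilon> where "\<epsilon> > 0" "\<And>t. 0 \<le> t \<and> t \<le> \<epsilon> \<Longrightarrow> z + t *\<^sub>R (z - w) \<in> solutions"
    using feasible_direction[OF z, of "z - w"] eq by (auto simp: inner_diff_right)
  then show ?thesis
    using eq by (intro exI[of _ \<epsilon>]) (auto simp: tight_face_def inner_add_right inner_diff_right)
qed

lemma tight_subset_face:
  assumes F: "F \<in> faces solutions" and z: "z \<in> F"
  shows "tight_face (active z) \<subseteq> F"
proof
  fix w assume w: "w \<in> tight_face (active z)"
  obtain f :: "'a \<times> 'b \<Rightarrow> real" where f: "linear f" "F = {z. is_arg_max f (\<lambda>z. z \<in> solutions) z}"
    using F unfolding faces_def by blast
  have zP: "z \<in> solutions" and zmax: "\<And>u. u \<in> solutions \<Longrightarrow> f u \<le> f z"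
    using z f by (auto simp: is_arg_max_linorder)
  obtain \<epsilon> where \<epsilon>: "\<epsilon> > 0" "z + \<epsilon> *\<^sub>R (z - w) \<in> solutions"
    using extend_beyond[OF zP w] by (auto simp: tight_face_def)
  have "f z + \<epsilon> * (f z - f w) \<le> f z"
    using zmax[OF \<epsilon>(2)] f(1) by (simp add: linear_add linear_diff linear_scale)
  then have "f z \<le> f w" using \<epsilon>(1) by (simp add: mult_le_0_iff)
  then show "w \<in> F"
    using zmax w f(2) by (force simp: is_arg_max_linorder tight_face_def)
qed

lemma chamber_eq_tight:
  "chamber solutions x = \<Inter> ((\<lambda>J. fst ` tight_face J) ` {active (x, y) |y. (x, y) \<in> solutions})"
proof (intro equalityI subsetI)
  fix w assume w: "w \<in> chamber solutions x"
  show "w \<in> \<Inter> ((\<lambda>J. fst ` tight_face J) ` {active (x, y) |y. (x, y) \<in> solutions})"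
  proof clarify
    fix y assume xy: "(x, y) \<in> solutions"
    then have "x \<in> fst ` tight_face (active (x, y))"
      using tight_activeI by force
    moreover have "tight_face (active (x, y)) \<in> faces solutions"
      by (rule tight_in_faces[OF xy])
    ultimately show "w \<in> fst ` tight_face (active (x, y))"
      using w unfolding chamber_def by blast
  qed
next
  fix w assume w: "w \<in> \<Inter> ((\<lambda>J. fst ` tight_face J) ` {active (x, y) |y. (x, y) \<in> solutions})"
  show "w \<in> chamber solutions x"
    unfolding chamber_def
  proof clarify
    fix F p assume F: "F \<in> faces solutions" and p: "p \<in> F" "x = fst p"
    have p_eq: "(x, snd p) = p" using p(2) by simp
    have "F \<subseteq> solutions" using F by (auto simp: faces_def is_arg_max_def)
    then have "active p \<in> {active (x, y) |y. (x, y) \<in> solutions}"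
      unfolding mem_Collect_eq by (intro exI[of _ "snd p"]) (use p(1) p_eq in auto)
    from INT_D[OF w this] have "w \<in> fst ` tight_face (active p)" .
    then show "w \<in> fst ` F" using tight_subset_face[OF F p(1)] by blast
  qed
qed

lemma finite_chamber_complex: "finite (chamber_complex solutions)"
proof (rule finite_subset)
  show "chamber_complex solutions \<subseteq> (\<lambda>\<J>. \<Inter> ((\<lambda>J. fst ` tight_face J) ` \<J>)) ` Pow (Pow I)"
  proof
    fix C assume "C \<in> chamber_complex solutions"
    then obtain x where C: "C = chamber solutions x" by (auto simp: chamber_complex_def)
    have "{active (x, y) |y. (x, y) \<in> solutions} \<in> Pow (Pow I)"
      using active_subset by blast
    then show "C \<in> (\<lambda>\<J>. \<Inter> ((\<lambda>J. fst ` tight_face J) ` \<J>)) ` Pow (Pow I)"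
      unfolding C chamber_eq_tight by (rule imageI)
  qed
qed (use finite_rows in simp)

lemma mem_chamber_self: "x \<in> fst ` solutions \<Longrightarrow> x \<in> chamber solutions x"
  unfolding chamber_def by blast

lemma convex_chamber: "convex (chamber solutions x)"
proof -
  have "convex (fst ` tight_face J)" for J
    by (rule convex_linear_image[OF bounded_linear.linear[OF bounded_linear_fst] convex_tight])
  then show ?thesis
    unfolding chamber_eq_tight by (intro convex_Inter) auto
qed

lemma chamber_tightD:
  assumes w: "w \<in> chamber solutions x" and xy: "(x, y) \<in> solutions"
  obtains v where "(w, v) \<in> tight_face (active (x, y))"
proof -
  have "active (x, y) \<in> {active (x, y) |y. (x, y) \<in> solutions}" using xy by blast
  from INT_D[OF w[unfolded chamber_eq_tight] this] show thesis using that by auto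
qed

text \<open>
  A chamber is convex, so it suffices to prolong every segment from a point \<open>w\<close> of the chamber a
  little beyond \<open>x\<close>. This is possible within each of the finitely many faces involved.
\<close>

lemma mem_rel_interior_chamber:
  assumes x: "x \<in> fst ` solutions"
  shows "x \<in> rel_interior (chamber solutions x)"
proof -
  let ?C = "chamber solutions x" and ?\<J> = "{active (x, y) |y. (x, y) \<in> solutions}"
  have fin: "finite ?\<J>"
    by (rule finite_subset[of _ "Pow I"]) (use active_subset finite_rows in auto)
  have "\<exists>e>1. (1 - e) *\<^sub>R w + e *\<^sub>R x \<in> ?C" if w: "w \<in> ?C" for w
  proof -
    have ev: "\<forall>\<^sub>F t in at_right 0. x + t *\<^sub>R (x - w) \<in> fst ` tight_face J" if J: "J \<in> ?\<J>" for J
    proof -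
      obtain y where y: "(x, y) \<in> solutions" "J = active (x, y)" using J by auto
      obtain v where v: "(w, v) \<in> tight_face J" using chamber_tightD[OF w y(1)] y(2) by auto
      obtain \<epsilon> where \<epsilon>: "\<epsilon> > 0"
        "\<And>t. 0 \<le> t \<Longrightarrow> t \<le> \<epsilon> \<Longrightarrow> (x, y) + t *\<^sub>R ((x, y) - (w, v)) \<in> tight_face J"
        using extend_beyond[OF y(1)] v y(2) by blast
      show ?thesis
      proof (rule eventually_at_rightI[of 0 \<epsilon>])
        fix t assume "t \<in> {0<..<\<epsilon>}"
        then have "(x, y) + t *\<^sub>R ((x, y) - (w, v)) \<in> tight_face J" using \<epsilon> by simp
        then show "x + t *\<^sub>R (x - w) \<in> fst ` tight_face J" by force
      qed (use \<epsilon> in simp)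
    qed
    have "\<forall>\<^sub>F t in at_right 0. \<forall>J\<in>?\<J>. x + t *\<^sub>R (x - w) \<in> fst ` tight_face J"
      by (intro eventually_ball_finite[OF fin] ballI ev)
    then obtain b where b: "b > 0"
      "\<And>t. 0 < t \<Longrightarrow> t < b \<Longrightarrow> \<forall>J\<in>?\<J>. x + t *\<^sub>R (x - w) \<in> fst ` tight_face J"
      unfolding eventually_at_right[OF zero_less_one] by blast
    have "x + (b / 2) *\<^sub>R (x - w) \<in> ?C"
      using b(2)[of "b / 2"] b(1) unfolding chamber_eq_tight by simp
    moreover have "(1 - (1 + b / 2)) *\<^sub>R w + (1 + b / 2) *\<^sub>R x = x + (b / 2) *\<^sub>R (x - w)"
      by (simp add: algebra_simps)
    ultimately show ?thesis
      using b(1) by (intro exI[of _ "1 + b / 2"]) simp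
  qed
  then show ?thesis
    using convex_rel_interior_iff[OF convex_chamber] mem_chamber_self[OF x] by blast
qed

text \<open>
  If \<open>u\<close> were better than \<open>y\<close> in the fibre of \<open>x\<close>, then \<open>(0, u - y)\<close> would be an improving feasible
  direction at \<open>(x', y')\<close>: the rows active there are also active at \<open>(x, y)\<close>.
\<close>

lemma fibre_optimality_transfer:
  fixes h :: "'b \<Rightarrow> real"
  assumes h: "linear h" and opt: "is_arg_min h (\<lambda>y. (x', y) \<in> solutions) y'"
    and t: "(x, y) \<in> tight_face (active (x', y'))"
  shows "is_arg_min h (\<lambda>y. (x, y) \<in> solutions) y"
  unfolding is_arg_min_linorder
proof (intro conjI allI impI)
  show "(x, y) \<in> solutions" using t by (simp add: tight_face_def)
next
  fix u assume u: "(x, u) \<in> solutions"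
  have xy': "(x', y') \<in> solutions" and min: "\<And>v. (x', v) \<in> solutions \<Longrightarrow> h y' \<le> h v"
    using opt by (auto simp: is_arg_min_linorder)
  have "a i \<bullet> (0, u - y) \<le> 0" if "i \<in> active (x', y')" for i
  proof -
    have "a i \<bullet> (x, u) \<le> \<beta> i" "a i \<bullet> (x, y) = \<beta> i"
      using that t u active_subset by (auto simp: tight_face_def solutions_def)
    moreover have "(0, u - y) = (x, u) - (x, y)" by simp
    ultimately show ?thesis by (simp only: inner_diff_right)
  qed
  from feasible_direction[OF xy' this] obtain \<epsilon>
    where \<epsilon>: "\<epsilon> > 0" "(x', y') + \<epsilon> *\<^sub>R (0, u - y) \<in> solutions" by auto
  then have "h y' \<le> h (y' + \<epsilon> *\<^sub>R (u - y))" using min by simp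
  then have "0 \<le> \<epsilon> * (h u - h y)" using h by (simp add: linear_add linear_diff linear_scale)
  then show "h y \<le> h u" using \<epsilon>(1) by (simp add: zero_le_mult_iff)
qed

lemma fibre_minimizer_exists:
  fixes h :: "'b \<Rightarrow> real"
  assumes cp: "compact solutions" and h: "linear h" and x: "x \<in> fst ` solutions"
  shows "\<exists>y. is_arg_min h (\<lambda>y. (x, y) \<in> solutions) y"
proof -
  let ?S = "{y. (x, y) \<in> solutions}"
  have "?S = snd ` (solutions \<inter> {x} \<times> UNIV)" by force
  moreover have "compact (solutions \<inter> {x} \<times> UNIV)"
    by (intro compact_Int_closed cp closed_Times) auto
  ultimately have "compact ?S"
    by (simp add: compact_continuous_image continuous_on_snd)
  moreover have "?S \<noteq> {}" using x by auto
  moreover have "continuous_on ?S h"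
    using h by (simp add: linear_continuous_on linear_conv_bounded_linear)
  ultimately have "\<exists>y\<in>?S. \<forall>u\<in>?S. h y \<le> h u"
    by (rule continuous_attains_inf)
  then show ?thesis by (auto simp: is_arg_min_linorder)
qed

text \<open>
  Any face \<open>F\<close> whose projection contains \<open>x\<close> also meets the fibre of \<open>x'\<close>. The segment from \<open>x'\<close>
  through \<open>x\<close> extends to a point \<open>x''\<close> of the chamber. If \<open>F\<close> maximizes \<open>f\<close>, the maximum of \<open>f\<close> over
  the fibres is affine between \<open>x'\<close> and \<open>x''\<close>, and it attains its largest value in between, at \<open>x\<close>;
  so it is constant and is attained over \<open>x'\<close> as well.
\<close>

lemma chamber_eqI:
  assumes cp: "compact solutions" and x': "x' \<in> fst ` solutions"
    and x: "x \<in> rel_interior (chamber solutions x')"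
  shows "chamber solutions x = chamber solutions x'"
proof -
  let ?C = "chamber solutions x'"
  have xC: "x \<in> ?C" using x rel_interior_subset by blast
  obtain e where e: "e > 1" "(1 - e) *\<^sub>R x' + e *\<^sub>R x \<in> ?C"
    using x mem_chamber_self[OF x'] convex_rel_interior_iff[OF convex_chamber] xC by blast
  define x'' where "x'' = (1 - e) *\<^sub>R x' + e *\<^sub>R x"
  have x_eq: "x = (1 - 1 / e) *\<^sub>R x' + (1 / e) *\<^sub>R x''"
  proof -
    have "(1 / e) *\<^sub>R x'' = ((1 - e) / e) *\<^sub>R x' + x"
      using e(1) by (simp add: x''_def scaleR_add_right)
    moreover have "(1 - e) / e = - (1 - 1 / e)"
      using e(1) by (simp add: field_simps)
    ultimately show ?thesis by (simp only: scaleR_minus_left) simp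
  qed
  have key: "x' \<in> fst ` F" if F: "F \<in> faces solutions" and xF: "x \<in> fst ` F" for F
  proof -
    obtain f :: "'a \<times> 'b \<Rightarrow> real" where f: "linear f" "F = {z. is_arg_max f (\<lambda>z. z \<in> solutions) z}"
      using F unfolding faces_def by blast
    obtain y where y: "(x, y) \<in> F" using xF by auto
    then have xy: "(x, y) \<in> solutions" and max: "\<And>u. u \<in> solutions \<Longrightarrow> f u \<le> f (x, y)"
      using f(2) by (auto simp: is_arg_max_linorder)
    \<comment> \<open>minimizing \<open>h\<close> over a fibre maximizes \<open>f\<close> there\<close>
    define h where "h v = - f (0, v)" for v
    have h: "linear h"
    proof (rule linearI)
      show "h (u + v) = h u + h v" for u v
        using linear_add[OF f(1), of "(0, u)" "(0, v)"] by (simp add: h_def)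
      show "h (r *\<^sub>R u) = r *\<^sub>R h u" for r u
        using linear_scale[OF f(1), of r "(0, u)"] by (simp add: h_def)
    qed
    have f_split: "f (p, v) = f (p, 0) - h v" for p v
      using linear_add[OF f(1), of "(p, 0)" "(0, v)"] by (simp add: h_def)
    obtain y' where y': "is_arg_min h (\<lambda>y. (x', y) \<in> solutions) y'"
      using fibre_minimizer_exists[OF cp h x'] by blast
    then have xy': "(x', y') \<in> solutions" by (simp add: is_arg_min_def)
    obtain y'' where y'': "(x'', y'') \<in> tight_face (active (x', y'))"
      using chamber_tightD[OF e(2) xy'] x''_def by auto
    define u where "u = (1 - 1 / e) *\<^sub>R y' + (1 / e) *\<^sub>R y''"
    have xu: "(x, u) = (1 - 1 / e) *\<^sub>R (x', y') + (1 / e) *\<^sub>R (x'', y'')"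
      using x_eq by (simp add: u_def)
    have "(x, u) \<in> tight_face (active (x', y'))"
      unfolding xu using e(1) y'' tight_activeI[OF xy']
      by (intro convexD[OF convex_tight]) auto
    then have "is_arg_min h (\<lambda>y. (x, y) \<in> solutions) u"
      by (rule fibre_optimality_transfer[OF h y'])
    then have "h u \<le> h y" using xy by (simp add: is_arg_min_linorder)
    then have "f (x, y) \<le> f (x, u)" using f_split[of x y] f_split[of x u] by simp
    also have "f (x, u) = (1 - 1 / e) * f (x', y') + (1 / e) * f (x'', y'')"
      unfolding xu using f(1) by (simp only: linear_add linear_scale) simp
    also have "\<dots> \<le> (1 - 1 / e) * f (x', y') + (1 / e) * f (x, y)"
      using max[of "(x'', y'')"] y'' e(1) by (intro add_left_mono mult_left_mono) (auto simp: tight_face_def)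
    finally have "(1 - 1 / e) * f (x, y) \<le> (1 - 1 / e) * f (x', y')"
      by (simp add: algebra_simps)
    then have "f (x, y) \<le> f (x', y')" using e(1) by simp
    then have "(x', y') \<in> F"
      using xy' max f(2) by (force simp: is_arg_max_linorder)
    then show ?thesis by force
  qed
  have mem: "x \<in> fst ` F" if "F \<in> faces solutions" "x' \<in> fst ` F" for F
    using xC that unfolding chamber_def by blast
  have "{fst ` F |F. F \<in> faces solutions \<and> x \<in> fst ` F} = {fst ` F |F. F \<in> faces solutions \<and> x' \<in> fst ` F}"
    using key mem by blast
  then show ?thesis unfolding chamber_def by simp
qed

text \<open>Exactly one summand of the piecewise linear expression at \<open>x\<close> survives, that of the chamber of \<open>x\<close>.\<close>

lemma piecewise_linear_overI:
  assumes cp: "compact solutions"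
    and aff: "\<And>x'. x' \<in> fst ` solutions \<Longrightarrow>
      \<exists>d r. \<forall>x \<in> chamber solutions x'. f x = d \<bullet> x + r"
  shows "piecewise_linear_over f (fst ` solutions) (chamber_complex solutions)"
proof -
  have "\<exists>d r. \<forall>x \<in> C. f x = d \<bullet> x + r" if "C \<in> chamber_complex solutions" for C
    using that aff by (auto simp: chamber_complex_def)
  then obtain d r where dr: "\<And>C x. C \<in> chamber_complex solutions \<Longrightarrow> x \<in> C \<Longrightarrow> f x = d C \<bullet> x + r C"
    by metis
  have "f x = (\<Sum>C\<in>chamber_complex solutions. (d C \<bullet> x + r C) * indicator (rel_interior C) x)"
    if x: "x \<in> fst ` solutions" for x
  proof -
    let ?C = "chamber solutions x"
    have C: "?C \<in> chamber_complex solutions" using x by (simp add: chamber_complex_def)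
    have zero: "(d C \<bullet> x + r C) * indicator (rel_interior C) x = 0"
      if "C \<in> chamber_complex solutions - {?C}" for C
    proof -
      have "x \<notin> rel_interior C"
        using that chamber_eqI[OF cp] by (auto simp: chamber_complex_def)
      then show ?thesis by simp
    qed
    have "(\<Sum>C\<in>chamber_complex solutions. (d C \<bullet> x + r C) * indicator (rel_interior C) x)
        = (d ?C \<bullet> x + r ?C) * indicator (rel_interior ?C) x"
    proof -
      have "(\<Sum>C\<in>chamber_complex solutions - {?C}. (d C \<bullet> x + r C) * indicator (rel_interior C) x) = 0"
        using zero by (intro sum.neutral ballI)
      then show ?thesis unfolding sum.remove[OF finite_chamber_complex C] by (simp only: add_0_right)
    qed
    also have "\<dots> = f x"
      using mem_rel_interior_chamber[OF x] dr[OF C mem_chamber_self[OF x]] by simp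
    finally show ?thesis by simp
  qed
  then show ?thesis
    unfolding piecewise_linear_over_def using finite_chamber_complex by blast
qed

text \<open>
  From a minimizer one can move both ways along a direction that is in the kernel of all active rows.
\<close>

lemma fibre_minimizer_kernel:
  fixes h :: "'b \<Rightarrow> real"
  assumes h: "linear h" and opt: "is_arg_min h (\<lambda>y. (x, y) \<in> solutions) y"
    and w: "\<And>i. i \<in> active (x, y) \<Longrightarrow> snd (a i) \<bullet> w = 0"
  shows "h w = 0"
    and "\<exists>t>0. is_arg_min h (\<lambda>y. (x, y) \<in> solutions) (y + t *\<^sub>R w)"
proof -
  have xy: "(x, y) \<in> solutions" and min: "\<And>v. (x, v) \<in> solutions \<Longrightarrow> h y \<le> h v"
    using opt by (auto simp: is_arg_min_linorder)
  have dir: "\<exists>t>0. (x, y + t *\<^sub>R v) \<in> solutions"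
    if "\<And>i. i \<in> active (x, y) \<Longrightarrow> snd (a i) \<bullet> v = 0" for v
    using feasible_direction[OF xy, of "(0, v)"] that by (auto simp: inner_prod_def)
  obtain t where t: "t > 0" "(x, y + t *\<^sub>R w) \<in> solutions" using dir w by blast
  obtain s where s: "s > 0" "(x, y + s *\<^sub>R (- w)) \<in> solutions" using dir[of "- w"] w by auto
  have "0 \<le> t * h w" using min[OF t(2)] h by (simp add: linear_add linear_scale)
  moreover have "s * h w \<le> 0"
    using min[OF s(2)] linear_add[OF h, of y "s *\<^sub>R (- w)"] linear_scale[OF h, of "- s" w] by simp
  ultimately show hw: "h w = 0"
    using t(1) s(1) by (simp add: zero_le_mult_iff mult_le_0_iff)
  then have "h (y + t *\<^sub>R w) = h y" using h by (simp add: linear_add linear_scale)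
  then show "\<exists>t>0. is_arg_min h (\<lambda>y. (x, y) \<in> solutions) (y + t *\<^sub>R w)"
    using t min by (auto simp: is_arg_min_linorder)
qed

text \<open>
  The hypothesis \<open>generic\<close> says that \<open>h\<close> does not vanish identically on any nonzero common kernel of
  the \<open>y\<close>-parts of a set of rows.
\<close>

lemma fibre_minimizer_unique:
  fixes h :: "'b \<Rightarrow> real"
  assumes h: "linear h"
    and generic: "\<And>J. J \<subseteq> I \<Longrightarrow> \<exists>w. w \<noteq> 0 \<and> (\<forall>i\<in>J. snd (a i) \<bullet> w = 0) \<Longrightarrow>
       \<exists>w. (\<forall>i\<in>J. snd (a i) \<bullet> w = 0) \<and> h w \<noteq> 0"
    and y: "is_arg_min h (\<lambda>y. (x, y) \<in> solutions) y" and y': "is_arg_min h (\<lambda>y. (x, y) \<in> solutions) y'"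
  shows "y = y'"
proof (rule ccontr)
  assume ne: "y \<noteq> y'"
  define m where "m = (1 / 2) *\<^sub>R y + (1 / 2) *\<^sub>R y'"
  have P: "(x, y) \<in> solutions" "(x, y') \<in> solutions" "h y = h y'"
    using y y' by (auto simp: is_arg_min_linorder intro: antisym)
  have m_eq: "(x, m) = (1 / 2) *\<^sub>R (x, y) + (1 / 2) *\<^sub>R (x, y')"
    by (simp add: m_def flip: scaleR_add_left)
  have row: "a i \<bullet> (x, m) = (a i \<bullet> (x, y) + a i \<bullet> (x, y')) / 2" for i
    unfolding m_eq by (simp only: inner_add_right inner_scaleR_right) simp
  have "(x, m) \<in> solutions"
    using P(1,2) unfolding solutions_def mem_Collect_eq row by fastforce
  moreover have "h m = h y" using h P(3) by (simp add: m_def linear_add linear_scale)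
  ultimately have m: "is_arg_min h (\<lambda>y. (x, y) \<in> solutions) m"
    using y by (auto simp: is_arg_min_linorder)
  have "snd (a i) \<bullet> (y - y') = 0" if i: "i \<in> active (x, m)" for i
  proof -
    have "i \<in> I" "a i \<bullet> (x, y) + a i \<bullet> (x, y') = 2 * \<beta> i"
      using i row[of i] by (auto simp: active_def)
    moreover from this(1) have "a i \<bullet> (x, y) \<le> \<beta> i" "a i \<bullet> (x, y') \<le> \<beta> i"
      using P by (auto simp: solutions_def)
    ultimately have "a i \<bullet> (x, y) = a i \<bullet> (x, y')" by linarith
    then show ?thesis by (simp add: inner_prod_def inner_diff_right)
  qed
  then have "\<exists>w. (\<forall>i\<in>active (x, m). snd (a i) \<bullet> w = 0) \<and> h w \<noteq> 0"
    using ne by (intro generic active_subset exI[of _ "y - y'"]) auto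
  then show False using fibre_minimizer_kernel(1)[OF h m] by blast
qed

text \<open>
  Over the chamber of \<open>x'\<close> the points \<open>(x, s x)\<close> lie in \<open>(x', s x') + V\<close>, where \<open>V\<close> is the kernel of the
  rows active at \<open>(x', s x')\<close>. By uniqueness of the minimizer, \<open>V\<close> contains no nonzero vector \<open>(0, w)\<close>, so
  \<open>fst\<close> has a linear inverse on \<open>V\<close>.
\<close>

lemma fibre_minimizer_affine:
  fixes h :: "'b \<Rightarrow> real"
  assumes h: "linear h" and x': "x' \<in> fst ` solutions"
    and uniq: "\<And>x. x \<in> fst ` solutions \<Longrightarrow> is_arg_min h (\<lambda>y. (x, y) \<in> solutions) (s x)"
      "\<And>x y. is_arg_min h (\<lambda>y. (x, y) \<in> solutions) y \<Longrightarrow> y = s x"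
  shows "\<exists>g. linear g \<and> (\<forall>x \<in> chamber solutions x'. s x = s x' + g (x - x'))"
proof -
  define J where "J = active (x', s x')"
  define V where "V = {z. \<forall>i\<in>J. a i \<bullet> z = 0}"
  have V: "subspace V"
    by (auto simp: V_def subspace_def inner_add_right)
  have "inj_on fst V"
    unfolding linear_injective_on_subspace_0[OF bounded_linear.linear[OF bounded_linear_fst] V]
  proof clarify
    fix p w assume pw: "(p, w) \<in> V" and p: "fst (p, w) = 0"
    have "snd (a i) \<bullet> w = 0" if "i \<in> active (x', s x')" for i
      using pw p that by (auto simp: V_def J_def inner_prod_def)
    from fibre_minimizer_kernel(2)[OF h uniq(1)[OF x'] this]
    obtain t where "t > 0" "s x' + t *\<^sub>R w = s x'" using uniq(2) by blast
    then show "(p, w) = 0" using p by (simp add: zero_prod_def)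
  qed
  then obtain g where g: "linear g" "\<And>v. v \<in> V \<Longrightarrow> g (fst v) = v"
    using linear_exists_left_inverse_on[OF bounded_linear.linear[OF bounded_linear_fst] V] by blast
  have "s x = s x' + snd (g (x - x'))" if x: "x \<in> chamber solutions x'" for x
  proof -
    have "(x', s x') \<in> solutions" using uniq(1)[OF x'] by (simp add: is_arg_min_def)
    from chamber_tightD[OF x this] obtain y where y: "(x, y) \<in> tight_face J" unfolding J_def .
    then have ysx: "y = s x"
      using fibre_optimality_transfer[OF h uniq(1)[OF x']] uniq(2) by (simp add: J_def)
    have "a i \<bullet> ((x, s x) - (x', s x')) = 0" if "i \<in> J" for i
      using y that unfolding inner_diff_right ysx by (auto simp: tight_face_def J_def active_def)
    then have "(x - x', s x - s x') \<in> V" by (simp add: V_def)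
    from g(2)[OF this] show ?thesis by simp
  qed
  moreover have "linear (\<lambda>v. snd (g v))"
    using linear_compose[OF g(1) bounded_linear.linear[OF bounded_linear_snd]] by (simp add: o_def)
  ultimately show ?thesis by blast
qed

lemma inner_fibre_minimizer_affine:
  fixes h :: "'b \<Rightarrow> real"
  assumes h: "linear h" and x': "x' \<in> fst ` solutions"
    and uniq: "\<And>x. x \<in> fst ` solutions \<Longrightarrow> is_arg_min h (\<lambda>y. (x, y) \<in> solutions) (s x)"
      "\<And>x y. is_arg_min h (\<lambda>y. (x, y) \<in> solutions) y \<Longrightarrow> y = s x"
  shows "\<exists>d r. \<forall>x \<in> chamber solutions x'. q \<bullet> s x = d \<bullet> x + r"
proof -
  obtain g where g: "linear g" "\<And>x. x \<in> chamber solutions x' \<Longrightarrow> s x = s x' + g (x - x')"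
    using fibre_minimizer_affine[OF h x' uniq] by blast
  have "q \<bullet> s x = adjoint g q \<bullet> x + (q \<bullet> s x' - adjoint g q \<bullet> x')"
    if "x \<in> chamber solutions x'" for x
    using g(2)[OF that] adjoint_works[OF g(1), of "x - x'" q]
    by (simp add: inner_add_right inner_diff_left inner_commute)
  then show ?thesis by blast
qed

end

section \<open>Great subspheres are null sets for the spherical Hausdorff measure\<close>

text \<open>
  From points of the unit sphere that are pairwise \<open>1 / K\<close> apart, form the \<open>K\<close>-fold larger set of the points
  \<open>(1 + j / K) *\<^sub>R x\<close> with \<open>j < K\<close>. It is still \<open>1 / K\<close>-separated, because scaling two unit vectors
  by factors at least 1 does not bring them closer, and two multiples of one unit vector are at least
  \<open>1 / K\<close> apart. Comparing volumes of the disjoint balls of radius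
  \<open>1 / (2 * K)\<close> bounds the number of points.
\<close>

lemma separated_card_bound:
  fixes A :: "'a::euclidean_space set" and K :: nat
  assumes U: "U \<in> lmeasurable"
    and ball: "\<And>z. z \<in> A \<Longrightarrow> \<forall>s\<in>{1..2}. ball (s *\<^sub>R z) (1 / K) \<subseteq> U"
    and A: "A \<subseteq> sphere 0 1" and K: "K > 0"
    and F: "F \<subseteq> A" "finite F" "\<And>x y. x \<in> F \<Longrightarrow> y \<in> F \<Longrightarrow> x \<noteq> y \<Longrightarrow> 1 / K \<le> dist x y"
  shows "real (card F) * K * (unit_ball_vol (real DIM('a)) * (1 / (2 * K)) ^ DIM('a)) \<le> measure lebesgue U"
proof -
  define p where "p = (\<lambda>(x::'a, j::nat). (1 + j / K) *\<^sub>R x)"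
  define B where "B q = ball (p q) (1 / (2 * K))" for q
  have sep: "1 / K \<le> dist (p q) (p q')" if q: "q \<in> F \<times> {..<K}" "q' \<in> F \<times> {..<K}" "q \<noteq> q'" for q q'
  proof -
    obtain x j x' j' where qq: "q = (x, j)" "q' = (x', j')" by fastforce
    let ?s = "1 + j / K" and ?t = "1 + j' / K"
    have x: "x \<in> F" "x' \<in> F" and n: "norm x = 1" "norm x' = 1"
      using q qq F A by auto
    have xx: "x \<bullet> x = 1" "x' \<bullet> x' = 1" using n by (simp_all add: norm_eq_1)
    have s1: "?s \<ge> 1" "?t \<ge> 1" by auto
    have cs: "0 \<le> 1 - x \<bullet> x'" using norm_cauchy_schwarz[of x x'] n by simp
    have d: "(dist x x')\<^sup>2 = 2 * (1 - x \<bullet> x')"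
      using xx by (simp add: dist_norm power2_norm_eq_inner inner_diff_left inner_diff_right inner_commute)
    \<comment> \<open>the cosine rule, with \<open>1 - x \<bullet> x'\<close> in place of the angle\<close>
    have law: "(dist (s *\<^sub>R x) (t *\<^sub>R x'))\<^sup>2 = (s - t)\<^sup>2 + s * t * (2 * (1 - x \<bullet> x'))" for s t
      unfolding dist_norm power2_norm_eq_inner using xx
      by (simp add: inner_commute[of x' x] power2_eq_square algebra_simps)
    then have eq: "(dist (p q) (p q'))\<^sup>2 = (?s - ?t)\<^sup>2 + ?s * ?t * (2 * (1 - x \<bullet> x'))"
      unfolding qq p_def split .
    have "(1 / K)\<^sup>2 \<le> (dist (p q) (p q'))\<^sup>2"
    proof (cases "x = x'")
      case True
      then have "j \<noteq> j'" using q qq by auto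
      then have "1 \<le> \<bar>real j - real j'\<bar>" by linarith
      moreover have "?s - ?t = (real j - real j') / K" by (simp add: diff_divide_distrib)
      ultimately have "1 / K \<le> \<bar>?s - ?t\<bar>" using K by (simp add: abs_divide divide_right_mono)
      then have "(1 / K)\<^sup>2 \<le> (?s - ?t)\<^sup>2" by (metis abs_of_nonneg of_nat_0_le_iff divide_nonneg_nonneg zero_le_one power2_abs power_mono)
      then show ?thesis unfolding eq using s1 cs by (simp add: add_increasing2)
    next
      case False
      then have "(1 / K)\<^sup>2 \<le> (dist x x')\<^sup>2"
        using F(3)[OF x] by (intro power_mono) auto
      also have "\<dots> \<le> ?s * ?t * (2 * (1 - x \<bullet> x'))"
        unfolding d using mult_mono[OF s1] s1 cs by (intro mult_le_cancel_right1[THEN iffD2]) auto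
      finally show ?thesis unfolding eq by (simp add: add_increasing)
    qed
    then show ?thesis by (rule power2_le_imp_le) simp
  qed
  have inj: "inj_on p (F \<times> {..<K})"
  proof (rule inj_onI, rule ccontr)
    fix q q' assume "q \<in> F \<times> {..<K}" "q' \<in> F \<times> {..<K}" "p q = p q'" "q \<noteq> q'"
    then have "1 / K \<le> 0" using sep by (metis dist_self)
    then show False using K by simp
  qed
  have disj: "pairwise (\<lambda>q q'. disjnt (B q) (B q')) (F \<times> {..<K})"
    unfolding pairwise_def B_def disjnt_def
  proof (intro ballI impI disjoint_ballI)
    fix q q' assume "q \<in> F \<times> {..<K}" "q' \<in> F \<times> {..<K}" "q \<noteq> q'"
    from sep[OF this] show "1 / (2 * K) + 1 / (2 * K) \<le> dist (p q) (p q')"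
      by simp
  qed
  have sub: "(\<Union>q\<in>F \<times> {..<K}. B q) \<subseteq> U"
  proof (rule UN_least)
    fix q assume "q \<in> F \<times> {..<K}"
    then obtain x j where q: "q = (x, j)" "x \<in> A" "j < K" using F by auto
    have "ball ((1 + j / K) *\<^sub>R x) (1 / K) \<subseteq> U"
      using ball[OF q(2)] q(3) K by simp
    moreover have "B q \<subseteq> ball ((1 + j / K) *\<^sub>R x) (1 / K)"
      unfolding B_def q p_def split using K by (intro subset_ball) (simp add: field_simps)
    ultimately show "B q \<subseteq> U" by blast
  qed
  have "real (card F) * K * (unit_ball_vol (real DIM('a)) * (1 / (2 * K)) ^ DIM('a))
      = (\<Sum>q\<in>F \<times> {..<K}. measure lebesgue (B q))"
    by (simp add: B_def content_ball card_cartesian_product)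
  also have "\<dots> = measure lebesgue (\<Union>q\<in>F \<times> {..<K}. B q)"
    using disj F(2) by (intro measure_UNION'[symmetric]) (auto simp: B_def)
  also have "\<dots> \<le> measure lebesgue U"
    using sub F(2) by (intro measure_mono_fmeasurable[OF _ _ U]) (auto simp: B_def)
  finally show ?thesis .
qed

text \<open>
  Let \<open>A\<close> be the great subsphere and \<open>T\<close> the part of the hyperplane with norm between 1 and 2, a compact
  Lebesgue null set. A maximal \<open>1 / K\<close>-separated set \<open>F \<subseteq> A\<close> yields a cover of \<open>A\<close> by balls of radius
  \<open>1 / K\<close> whose gauges sum to a constant multiple of \<open>card F * K * (1 / K) ^ n\<close>. By
  \<open>separated_card_bound\<close> this is at most a constant times the volume of a neighbourhood of \<open>T\<close>, which is arbitrarily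
  small.
\<close>

lemma hausdorff_measure_great_subsphere:
  fixes v :: "'a::euclidean_space"
  assumes v: "v \<noteq> 0"
  shows "hausdorff_measure (DIM('a) - 1) {z \<in> sphere 0 1. v \<bullet> z = 0} = 0"
proof -
  define A where "A = {z \<in> sphere 0 1. v \<bullet> z = 0}"
  define T where "T = {z. 1 \<le> norm z \<and> norm z \<le> 2 \<and> v \<bullet> z = 0}"
  define n where "n = DIM('a)"
  have n: "n > 0" by (simp add: n_def)
  let ?\<omega> = "unit_ball_vol (real n)" and ?\<omega>' = "unit_ball_vol (real (n - 1))"
  have "T = cball 0 2 \<inter> {z. 1 \<le> norm z} \<inter> {z. v \<bullet> z = 0}"
    by (auto simp: T_def)
  moreover have "closed {z::'a. 1 \<le> norm z}"
    by (intro closed_Collect_le continuous_intros)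
  ultimately have "compact T"
    by (metis compact_Int_closed closed_hyperplane compact_cball)
  have "negligible T"
    by (rule negligible_subset[OF negligible_hyperplane[of v 0]]) (use v in \<open>auto simp: T_def\<close>)
  have small: "hausdorff_premeasure (n - 1) \<delta> A \<le> ennreal e"
    if \<delta>: "\<delta> > 0" and e: "e > 0" for \<delta> e
  proof -
    \<comment> \<open>the ratio of the sum of the gauges of the cover to the packed volume\<close>
    define C where "C = ?\<omega>' * 2 ^ n / ?\<omega>"
    have C: "C > 0" by (simp add: C_def)
    obtain U where U: "open U" "T \<subseteq> U" "U - T \<in> lmeasurable" "emeasure lebesgue (U - T) < ennreal (e / C)"
      using sets_lebesgue_outer_open[OF negligible_imp_sets[OF \<open>negligible T\<close>], of "e / C"] e C by auto
    have UT: "U = (U - T) \<union> T" using U(2) by blast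
    have Um: "U \<in> lmeasurable"
      using fmeasurable.Un[OF U(3) negligible_imp_measurable[OF \<open>negligible T\<close>]] unfolding UT[symmetric] .
    have "emeasure lebesgue U \<le> emeasure lebesgue (U - T) + emeasure lebesgue T"
      using U(3) negligible_imp_sets[OF \<open>negligible T\<close>] by (subst UT) (rule emeasure_subadditive, auto)
    also have "emeasure lebesgue T = 0"
      using \<open>negligible T\<close> by (metis negligible_iff_null_sets null_setsD1)
    finally have "emeasure lebesgue U < ennreal (e / C)" using U(4) by simp
    then have vol: "measure lebesgue U \<le> e / C"
      using Um e C by (simp add: emeasure_eq_measure2 ennreal_less_iff)
    obtain \<epsilon> where \<epsilon>: "\<epsilon> > 0" "(\<Union>x\<in>T. ball x \<epsilon>) \<subseteq> U"
      using compact_subset_open_imp_ball_epsilon_subset[OF \<open>compact T\<close> U(1,2)] by blast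
    obtain k where k: "inverse (real (Suc k)) < min \<epsilon> (\<delta> / 2)"
      using reals_Archimedean[of "min \<epsilon> (\<delta> / 2)"] \<epsilon> \<delta> by auto
    define K where "K = Suc k"
    have K: "K > 0" "1 / K < min \<epsilon> (\<delta> / 2)"
      using k by (simp_all only: K_def inverse_eq_divide zero_less_Suc)
    define sep where "sep F \<longleftrightarrow> F \<subseteq> A \<and> finite F \<and> (\<forall>x\<in>F. \<forall>y\<in>F. x \<noteq> y \<longrightarrow> 1 / K \<le> dist x y)" for F
    let ?c = "K * (?\<omega> * (1 / (2 * K)) ^ n)"
    have c: "?c > 0" using K by simp
    have bound: "real (card F) * ?c \<le> e / C" if "sep F" for F
    proof -
      have "\<forall>s\<in>{1..2}. ball (s *\<^sub>R z) (1 / K) \<subseteq> U" if z: "z \<in> A" for z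
      proof
        fix s :: real assume s: "s \<in> {1..2}"
        then have "s *\<^sub>R z \<in> T" using z by (simp add: T_def A_def)
        moreover have "ball (s *\<^sub>R z) (1 / K) \<subseteq> ball (s *\<^sub>R z) \<epsilon>" using K(2) by (intro subset_ball) simp
        ultimately show "ball (s *\<^sub>R z) (1 / K) \<subseteq> U" using \<epsilon>(2) by blast
      qed
      then have "real (card F) * K * (?\<omega> * (1 / (2 * K)) ^ n) \<le> measure lebesgue U"
        unfolding n_def
        by (rule separated_card_bound[where A = A, OF Um _ _ K(1)]) (use that in \<open>auto simp: sep_def A_def\<close>)
      then show ?thesis using vol by (simp add: mult.assoc)
    qed
    have "card F < Suc (nat \<lceil>e / C / ?c\<rceil>)" if "sep F" for F
    proof -
      have "real (card F) \<le> e / C / ?c"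
        using bound[OF that] by (simp only: pos_le_divide_eq[OF c])
      then show ?thesis by linarith
    qed
    moreover have "sep {}" by (simp add: sep_def)
    ultimately obtain F where F: "sep F" and max: "\<And>G. sep G \<Longrightarrow> card G \<le> card F"
      using ex_has_greatest_nat[of sep "{}" card] by blast
    have cover: "A \<subseteq> (\<Union>x\<in>F. cball x (1 / K))"
    proof
      fix z assume z: "z \<in> A"
      show "z \<in> (\<Union>x\<in>F. cball x (1 / K))"
      proof (rule ccontr)
        assume far: "z \<notin> (\<Union>x\<in>F. cball x (1 / K))"
        then have "z \<notin> F" by auto
        \<comment> \<open>this contradicts the maximality of \<open>F\<close>\<close>
        have "sep (insert z F)"
          using F z far by (force simp: sep_def dist_commute)
        from max[OF this] show False using F \<open>z \<notin> F\<close> by (simp add: sep_def)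
      qed
    qed
    have "finite F" using F by (simp add: sep_def)
    then obtain x where x: "bij_betw x {..<card F} F"
      using bij_betw_from_nat_into_finite by metis
    define V where "V i = (if i < card F then cball (x i) (1 / K) else {})" for i
    have "(\<Union>z\<in>F. cball z (1 / K)) = (\<Union>z\<in>x ` {..<card F}. cball z (1 / K))"
      by (simp only: bij_betw_imp_surj_on[OF x])
    also have "\<dots> \<subseteq> (\<Union>i. V i)"
      by (auto simp: V_def)
    finally have V: "V \<in> {U. A \<subseteq> (\<Union>i. U i) \<and> (\<forall>i. bounded (U i) \<and> diameter (U i) \<le> \<delta>)}"
      using cover K \<delta> by (auto simp: V_def)
    have gauge: "hausdorff_gauge (n - 1) (V i) = (if i < card F then ennreal (?\<omega>' * (1 / K) ^ (n - 1)) else 0)" for i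
      using K by (simp add: hausdorff_gauge_def V_def)
    have "hausdorff_premeasure (n - 1) \<delta> A \<le> (\<Sum>i. hausdorff_gauge (n - 1) (V i))"
      unfolding hausdorff_premeasure_def by (rule INF_lower[OF V])
    also have "\<dots> = (\<Sum>i<card F. ennreal (?\<omega>' * (1 / K) ^ (n - 1)))"
      unfolding gauge by (subst suminf_finite[of "{..<card F}"]) auto
    also have "\<dots> = ennreal (card F * (?\<omega>' * (1 / K) ^ (n - 1)))"
      by (simp add: ennreal_of_nat_eq_real_of_nat flip: ennreal_mult')
    also have "\<dots> \<le> ennreal e"
    proof (rule ennreal_leI)
      have "(1 / real K) ^ (n - 1) = K * (1 / K) ^ n"
        using K n by (cases n) auto
      then have "card F * (?\<omega>' * (1 / K) ^ (n - 1)) = C * (card F * ?c)"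
        using K less_imp_neq[OF unit_ball_vol_pos[of "real n"]] by (simp add: C_def power_divide power_mult_distrib)
      also have "\<dots> \<le> C * (e / C)"
        using bound[OF F] C by (intro mult_left_mono) auto
      finally show "card F * (?\<omega>' * (1 / K) ^ (n - 1)) \<le> e" using C by simp
    qed
    finally show ?thesis .
  qed
  have "hausdorff_premeasure (n - 1) \<delta> A = 0" if "\<delta> > 0" for \<delta>
    using ennreal_le_epsilon[of 0 "hausdorff_premeasure (n - 1) \<delta> A"] small[OF that]
    by (simp add: le_zero_eq)
  then show ?thesis
    unfolding hausdorff_measure_def A_def n_def by simp
qed

section \<open>The sample avoids any given hyperplane\<close>

lemma sample_avoids_hyperplane:
  fixes c :: "'w \<Rightarrow> 'a::euclidean_space" and c' :: "nat \<Rightarrow> 'v \<Rightarrow> 'a"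
  assumes M: "prob_space M" and c: "c \<in> M \<rightarrow>\<^sub>M sphere_borel" and na: "nonatomic_distribution M c"
    and M': "prob_space M'" and s: "independent_sample M' c' I M c" and i: "i \<in> I" and v: "v \<noteq> 0"
  shows "AE \<omega> in M'. v \<bullet> c' i \<omega> \<noteq> 0"
proof -
  interpret M: prob_space M by fact
  interpret M': prob_space M' by fact
  define N where "N = {z \<in> sphere 0 1. v \<bullet> z = 0}"
  have "closed N"
  proof -
    have "N = sphere 0 1 \<inter> {z. v \<bullet> z = 0}" by (auto simp: N_def)
    then show ?thesis by (simp add: closed_Int closed_hyperplane)
  qed
  then have N: "N \<in> sets borel" by simp
  then have Ns: "N \<in> sets sphere_borel"
    by (subst sets_restrict_space_iff) (auto simp: N_def)
  have c': "c' i \<in> M' \<rightarrow>\<^sub>M sphere_borel"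
    using s i unfolding independent_sample_def M'.indep_vars_def by blast
  have "measure M {\<omega> \<in> space M. c \<omega> \<in> N} = 0"
  proof -
    have "N \<subseteq> sphere 0 1" by (auto simp: N_def)
    moreover have "hausdorff_measure (DIM('a) - 1) N = 0"
      unfolding N_def by (rule hausdorff_measure_great_subsphere[OF v])
    ultimately show ?thesis
      using na N unfolding nonatomic_distribution_def by blast
  qed
  moreover have "c -` N \<inter> space M = {\<omega> \<in> space M. c \<omega> \<in> N}" by auto
  ultimately have "emeasure (distr M sphere_borel c) N = 0"
    by (simp add: emeasure_distr[OF c Ns] M.emeasure_eq_measure)
  moreover have "distr M' sphere_borel (c' i) = distr M sphere_borel c"
    using s i by (simp add: independent_sample_def)
  ultimately have "emeasure M' (c' i -` N \<inter> space M') = 0"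
    using emeasure_distr[OF c' Ns] by simp
  then have "c' i -` N \<inter> space M' \<in> null_sets M'"
    using measurable_sets[OF c' Ns] by auto
  then show ?thesis
    by (rule AE_I') (use measurable_space[OF c'] in \<open>auto simp: N_def space_restrict_space\<close>)
qed

section \<open>The sample average\<close>

theorem theorem3p8:
  fixes A\<^sub>l :: "real^'nx^'ml" and b\<^sub>l :: "real^'ml"
    and A\<^sub>f :: "real^'nx^'mf" and B\<^sub>f :: "real^'ny^'mf" and b\<^sub>f :: "real^'mf"
    and d\<^sub>1 :: "real^'nx" and d\<^sub>2 :: "real^'ny"
    and D :: "((real^'nx) \<times> (real^'ny)) set" and X :: "(real^'nx) set"
    and M :: "'w measure" and c :: "'w \<Rightarrow> real^'ny"
    and M' :: "'v measure" and c' :: "nat \<Rightarrow> 'v \<Rightarrow> real^'ny" and N\<^sub>0 :: nat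
  assumes D: "D = feasible_set A\<^sub>l b\<^sub>l A\<^sub>f B\<^sub>f b\<^sub>f"
    and "compact D" and "full_dimensional D"
    and X: "X = fst ` D"
    and "prob_space M" and "c \<in> M \<rightarrow>\<^sub>M sphere_borel" and "nonatomic_distribution M c"
    and "prob_space M'" and "N\<^sub>0 \<ge> 1" and "independent_sample M' c' {1..N\<^sub>0} M c"
  shows "AE \<omega> in M'.
    (\<forall>x \<in> X. \<forall>i \<in> {1..N\<^sub>0}. \<exists>!y. y \<in> lower_argmin A\<^sub>f B\<^sub>f b\<^sub>f (c' i \<omega>) x) \<and>
    piecewise_linear_over (sample_average A\<^sub>f B\<^sub>f b\<^sub>f d\<^sub>1 d\<^sub>2 N\<^sub>0 (\<lambda>i. c' i \<omega>)) X (chamber_complex D)"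
proof -
  define a :: "'ml + 'mf \<Rightarrow> (real^'nx) \<times> (real^'ny)"
    where "a = case_sum (\<lambda>i. (A\<^sub>l $ i, 0)) (\<lambda>i. (A\<^sub>f $ i, B\<^sub>f $ i))"
  define \<beta> :: "'ml + 'mf \<Rightarrow> real" where "\<beta> = case_sum (($) b\<^sub>l) (($) b\<^sub>f)"
  interpret linear_system UNIV a \<beta>
    by standard simp
  have "solutions = {(x, y). (\<forall>i. A\<^sub>l $ i \<bullet> x \<le> b\<^sub>l $ i) \<and> (\<forall>i. A\<^sub>f $ i \<bullet> x + B\<^sub>f $ i \<bullet> y \<le> b\<^sub>f $ i)}"
    unfolding solutions_def by (auto simp: a_def \<beta>_def split_sum_all)
  then have D_eq: "D = solutions"
    by (simp add: D feasible_set_def less_eq_vec_def matrix_vector_mul_component)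
  have X_eq: "X = fst ` solutions" and cp: "compact solutions"
    using X D_eq \<open>compact D\<close> by simp_all
  have argmin_iff: "y \<in> lower_argmin A\<^sub>f B\<^sub>f b\<^sub>f e x \<longleftrightarrow> is_arg_min ((\<bullet>) e) (\<lambda>y. (x, y) \<in> solutions) y"
    if "x \<in> X" for e x y
  proof -
    have "(A\<^sub>f *v x + B\<^sub>f *v y \<le> b\<^sub>f) \<longleftrightarrow> (x, y) \<in> solutions" for y
      using that unfolding X D_eq[symmetric] D by (auto simp: feasible_set_def)
    then show ?thesis by (simp add: lower_argmin_def)
  qed
  \<comment> \<open>A minimizer can fail to be unique only if the rows active at some minimizer form a degenerate set.\<close>
  define degenerate where "degenerate = {J. \<exists>w. w \<noteq> 0 \<and> (\<forall>i\<in>J. snd (a i) \<bullet> w = 0)}"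
  have "\<forall>J\<in>degenerate. \<exists>w. w \<noteq> 0 \<and> (\<forall>i\<in>J. snd (a i) \<bullet> w = 0)"
    by (simp add: degenerate_def)
  from bchoice[OF this] obtain v
    where v: "\<And>J. J \<in> degenerate \<Longrightarrow> v J \<noteq> 0 \<and> (\<forall>i\<in>J. snd (a i) \<bullet> v J = 0)" by blast
  define generic where "generic e \<longleftrightarrow> (\<forall>J\<in>degenerate. v J \<bullet> e \<noteq> 0)" for e
  have "AE \<omega> in M'. \<forall>i\<in>{1..N\<^sub>0}. \<forall>J\<in>degenerate. v J \<bullet> c' i \<omega> \<noteq> 0"
    using sample_avoids_hyperplane[OF assms(5,6,7,8,10)] v
    by (intro AE_finite_allI) auto
  then have "AE \<omega> in M'. \<forall>i\<in>{1..N\<^sub>0}. generic (c' i \<omega>)"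
    by (simp add: generic_def)
  then show ?thesis
  proof eventually_elim
    case (elim \<omega>)
    define s where "s i = lower_solution A\<^sub>f B\<^sub>f b\<^sub>f (c' i \<omega>)" for i
    have lin: "linear ((\<bullet>) e)" for e :: "real^'ny"
      by (rule bounded_linear.linear[OF bounded_linear_inner_right])
    have unique: "\<exists>!y. y \<in> lower_argmin A\<^sub>f B\<^sub>f b\<^sub>f (c' i \<omega>) x" if x: "x \<in> X" and i: "i \<in> {1..N\<^sub>0}" for x i
    proof -
      have "\<exists>w. (\<forall>i\<in>J. snd (a i) \<bullet> w = 0) \<and> c' i \<omega> \<bullet> w \<noteq> 0"
        if "\<exists>w. w \<noteq> 0 \<and> (\<forall>i\<in>J. snd (a i) \<bullet> w = 0)" for J
      proof -
        have J: "J \<in> degenerate" using that by (simp add: degenerate_def)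
        then have "c' i \<omega> \<bullet> v J \<noteq> 0"
          using elim i by (auto simp: generic_def inner_commute)
        then show ?thesis using v[OF J] by blast
      qed
      from fibre_minimizer_unique[OF lin this]
      have "y = y'" if "is_arg_min ((\<bullet>) (c' i \<omega>)) (\<lambda>y. (x, y) \<in> solutions) y"
        "is_arg_min ((\<bullet>) (c' i \<omega>)) (\<lambda>y. (x, y) \<in> solutions) y'" for y y'
        using that by blast
      moreover have "\<exists>y. is_arg_min ((\<bullet>) (c' i \<omega>)) (\<lambda>y. (x, y) \<in> solutions) y"
        using fibre_minimizer_exists[OF cp lin] x X_eq by blast
      ultimately show ?thesis
        unfolding argmin_iff[OF x] by blast
    qed
    have s1: "is_arg_min ((\<bullet>) (c' i \<omega>)) (\<lambda>y. (x, y) \<in> solutions) (s i x)"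
      if "i \<in> {1..N\<^sub>0}" "x \<in> fst ` solutions" for i x
      using theI'[OF unique[OF _ that(1)]] that(2) argmin_iff X_eq
      by (simp add: s_def lower_solution_def)
    have s2: "y = s i x"
      if i: "i \<in> {1..N\<^sub>0}" and y: "is_arg_min ((\<bullet>) (c' i \<omega>)) (\<lambda>y. (x, y) \<in> solutions) y" for i x y
    proof -
      have "(x, y) \<in> solutions" using y by (simp add: is_arg_min_def)
      then have x: "x \<in> X" unfolding X_eq by (rule image_eqI[rotated]) simp
      then have "y \<in> lower_argmin A\<^sub>f B\<^sub>f b\<^sub>f (c' i \<omega>) x" using y argmin_iff by simp
      then show ?thesis
        unfolding s_def lower_solution_def using the1_equality[OF unique[OF x i]] by simp
    qed
    have "piecewise_linear_over (sample_average A\<^sub>f B\<^sub>f b\<^sub>f d\<^sub>1 d\<^sub>2 N\<^sub>0 (\<lambda>i. c' i \<omega>)) X (chamber_complex D)"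
      unfolding X_eq D_eq
    proof (rule piecewise_linear_overI[OF cp])
      fix x' assume x': "x' \<in> fst ` solutions"
      have "\<exists>d r. \<forall>x\<in>chamber solutions x'. d\<^sub>2 \<bullet> s i x = d \<bullet> x + r" if "i \<in> {1..N\<^sub>0}" for i
        using inner_fibre_minimizer_affine[OF lin x', of "c' i \<omega>" "s i"] s1[OF that] s2[OF that] by blast
      then obtain d r where dr:
        "\<And>i x. i \<in> {1..N\<^sub>0} \<Longrightarrow> x \<in> chamber solutions x' \<Longrightarrow> d\<^sub>2 \<bullet> s i x = d i \<bullet> x + r i"
        by metis
      \<comment> \<open>average the affine pieces of the \<open>N\<^sub>0\<close> solution maps over the chamber\<close>
      let ?d = "d\<^sub>1 + (1 / real N\<^sub>0) *\<^sub>R (\<Sum>i = 1..N\<^sub>0. d i)" and ?r = "1 / real N\<^sub>0 * (\<Sum>i = 1..N\<^sub>0. r i)"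
      have "sample_average A\<^sub>f B\<^sub>f b\<^sub>f d\<^sub>1 d\<^sub>2 N\<^sub>0 (\<lambda>i. c' i \<omega>) x = ?d \<bullet> x + ?r"
        if x: "x \<in> chamber solutions x'" for x
      proof -
        have "(\<Sum>i = 1..N\<^sub>0. d\<^sub>2 \<bullet> s i x) = (\<Sum>i = 1..N\<^sub>0. d i) \<bullet> x + (\<Sum>i = 1..N\<^sub>0. r i)"
          using dr x by (simp add: inner_sum_left sum.distrib)
        then show ?thesis
          by (simp add: sample_average_def s_def inner_add_left add_divide_distrib)
      qed
      then show "\<exists>d r. \<forall>x\<in>chamber solutions x'.
          sample_average A\<^sub>f B\<^sub>f b\<^sub>f d\<^sub>1 d\<^sub>2 N\<^sub>0 (\<lambda>i. c' i \<omega>) x = d \<bullet> x + r"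
        by blast
    qed
    then show ?case using unique by blast
  qed
qed

end
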